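(* Let $(E,\|\cdot\|_E)$ and $(F,\|\cdot\|_F)$ be normed Riesz spaces of real sequences with property $(PS)$, and suppose that $\|x\|_F=\lim_{n\to\infty}\|P_nx\|_F$ for all $x\in F$, where $P_nx=(x_1,\dots,x_n,0,0,\dots)$. Let $A=(a_{j,k})_{j,k\ge1}$ be a matrix with $a_{j,k}\ge 0$ for all $j,k$, which defines an operator from $E$ to $F$ by $(Ax)_j=\sum_{k=1}^\infty a_{j,k}x_k$. Assume that there is a positive integer $n_0$ such that for every $n\ge n_0$ and every $B=(b_{j,k})\in\bigcup_{0\le\gamma\le\lambda\le n+1}\mathcal R_{A_n}^{\gamma,\lambda}$ there exists $C=(c_{j,k})\in\mathcal R_{A_n}$ (depending on $n$ and $B$) with $$\sum_{j=1}^l\sum_{k=1}^r c_{j,k}\ \ge\ \sum_{j=1}^l\sum_{k\in N_r} b_{j,k}$$ for all $1\le l\le n$, all $r\ge1$ and all sets $N_r$ of positive integers with $|N_r|=r$. Then $\|Ax^*\|_F\ge\|Ax\|_F$ for all $x\in E$ with $x\ge0$. Hence decreasing elements of $E$ suffice to determine the norm of $A$, i.e. $\|A\|_{E,F}=\|A\|_{E,F,\downarrow}$.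
   Context: Decreasing means non-increasing; $x\ge0$ means $x_k\ge0$ for all $k$. For a real sequence $x$, $x^*$ denotes the decreasing rearrangement of $\{|x_k|\}$: $x_n^*$ is the $n$-th largest of the numbers $|x_k|$ counted with multiplicity, i.e. $x_n^*=\max_{|N|=n}\min_{k\in N}|x_k|$ over sets $N$ of $n$ indices; $x^*$ exists if all these maxima exist. A normed Riesz space of real sequences is a vector space of real sequences that is a vector lattice under the coordinatewise order and operations, with a norm such that $|x|\le|y|$ coordinatewise implies $\|x\|\le\|y\|$. Such a space $F$ has property $(PS)$ if for every $x\in F$ the sequence $x^*$ exists, and whenever $y$ is a real sequence for which $y^*$ exists and $y_1^*+\cdots+y_n^*\le x_1^*+\cdots+x_n^*$ for all $n\ge1$, then $y\in F$ and $\|y\|_F\le\|x\|_F$. $\|A\|_{E,F}=\sup_{\|x\|_E=1}\|Ax\|_F$ is the operator norm, and $\|A\|_{E,F,\downarrow}=\sup\{\|Ax\|_F:\|x\|_E=1,\ x\ge0,\ x\text{ decreasing}\}$ (both possibly $\infty$). $A_n$ is the $n\times\infty$ matrix formed by the first $n$ rows of $A$. For an $n\times\infty$ matrix $D$, $\mathcal R_D$ is the set of all matrices obtained from $D$ by permuting its rows. For integers $0\le\gamma\le\lambda\le n+1$, $\mathcal R_D^{\gamma,\lambda}$ is the set of $B=(b_{j,k})\in\mathcal R_D$ such that (row indices ranging over $1,\dots,n$, and inequalities in (i), (ii) holding for all $k\ge 1$): (i) $b_{j,k}\ge b_{j+1,k}$ whenever $1\le j\le n-1$ and ($j\le\gamma$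 or $j\ge\lambda$); (ii) $b_{r_1,k}\ge b_{j,k}$ whenever $r_1\le\gamma<j<\lambda$, and $b_{j,k}\ge b_{r_2,k}$ whenever $\gamma<j<\lambda\le r_2$; (iii) there is no $\alpha$ with $\gamma<\alpha<\lambda$ such that either $b_{\alpha,k}\ge b_{j,k}$ for all $\gamma<j<\lambda$ and all $k$, or $b_{\alpha,k}\le b_{j,k}$ for all $\gamma<j<\lambda$ and all $k$. *)

(* Conventions.  Sequences, matrix rows and matrix columns are indexed from 0, so that
   "x k" is the (k+1)-st term.  A space of sequences is a carrier set together with a
   norm function of which only the values on the carrier matter. *)

theory Defs
  imports "HOL-Analysis.Analysis" "HOL-Combinatorics.Permutations"
begin

section \<open>Decreasing rearrangement\<close>

definition min_vals :: "(nat \<Rightarrow> real) \<Rightarrow> nat \<Rightarrow> real set" where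
  "min_vals x n = {Min ((\<lambda>k. \<bar>x k\<bar>) ` N) | N. finite N \<and> card N = n}"

definition has_rearr :: "(nat \<Rightarrow> real) \<Rightarrow> bool" where
  "has_rearr x \<longleftrightarrow> (\<forall>n\<ge>1. \<exists>m\<in>min_vals x n. \<forall>s\<in>min_vals x n. s \<le> m)"

(* Entry n is the (n+1)-st largest absolute value; meaningful only if has_rearr x. *)
definition rearr :: "(nat \<Rightarrow> real) \<Rightarrow> nat \<Rightarrow> real" where
  "rearr x n = (GREATEST m. m \<in> min_vals x (Suc n))"

section \<open>Normed Riesz spaces of sequences\<close>

locale normed_riesz_seq_space =
  fixes E :: "(nat \<Rightarrow> real) set" and nrm :: "(nat \<Rightarrow> real) \<Rightarrow> real"
  assumes zero_mem: "(\<lambda>k. 0) \<in> E"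
    and add_mem: "\<lbrakk>x \<in> E; y \<in> E\<rbrakk> \<Longrightarrow> (\<lambda>k. x k + y k) \<in> E"
    and scale_mem: "x \<in> E \<Longrightarrow> (\<lambda>k. c * x k) \<in> E"
    and max_mem: "\<lbrakk>x \<in> E; y \<in> E\<rbrakk> \<Longrightarrow> (\<lambda>k. max (x k) (y k)) \<in> E"
    and min_mem: "\<lbrakk>x \<in> E; y \<in> E\<rbrakk> \<Longrightarrow> (\<lambda>k. min (x k) (y k)) \<in> E"
    and nrm_nonneg: "x \<in> E \<Longrightarrow> 0 \<le> nrm x"
    and nrm_eq_0_iff: "x \<in> E \<Longrightarrow> nrm x = 0 \<longleftrightarrow> x = (\<lambda>k. 0)"
    and nrm_scale: "x \<in> E \<Longrightarrow> nrm (\<lambda>k. c * x k) = \<bar>c\<bar> * nrm x"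
    and nrm_triangle: "\<lbrakk>x \<in> E; y \<in> E\<rbrakk> \<Longrightarrow> nrm (\<lambda>k. x k + y k) \<le> nrm x + nrm y"
    and nrm_mono: "\<lbrakk>x \<in> E; y \<in> E; \<And>k. \<bar>x k\<bar> \<le> \<bar>y k\<bar>\<rbrakk> \<Longrightarrow> nrm x \<le> nrm y"

definition property_PS :: "(nat \<Rightarrow> real) set \<Rightarrow> ((nat \<Rightarrow> real) \<Rightarrow> real) \<Rightarrow> bool" where
  "property_PS F nrm \<longleftrightarrow>
     (\<forall>x\<in>F. has_rearr x \<and>
        (\<forall>y. has_rearr y \<and> (\<forall>n\<ge>1. (\<Sum>i<n. rearr y i) \<le> (\<Sum>i<n. rearr x i))
             \<longrightarrow> y \<in> F \<and> nrm y \<le> nrm x))"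

definition trunc_seq :: "nat \<Rightarrow> (nat \<Rightarrow> real) \<Rightarrow> nat \<Rightarrow> real" where
  "trunc_seq n x = (\<lambda>k. if k < n then x k else 0)"

section \<open>Matrix operators\<close>

definition mat_app :: "(nat \<Rightarrow> nat \<Rightarrow> real) \<Rightarrow> (nat \<Rightarrow> real) \<Rightarrow> nat \<Rightarrow> real" where
  "mat_app A x = (\<lambda>j. \<Sum>k. A j k * x k)"

definition defines_operator ::
    "(nat \<Rightarrow> nat \<Rightarrow> real) \<Rightarrow> (nat \<Rightarrow> real) set \<Rightarrow> (nat \<Rightarrow> real) set \<Rightarrow> bool" where
  "defines_operator A E F \<longleftrightarrow>
     (\<forall>x\<in>E. (\<forall>j. summable (\<lambda>k. A j k * x k)) \<and> mat_app A x \<in> F)"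

definition op_norm :: "(nat \<Rightarrow> real) set \<Rightarrow> ((nat \<Rightarrow> real) \<Rightarrow> real) \<Rightarrow>
    ((nat \<Rightarrow> real) \<Rightarrow> real) \<Rightarrow> (nat \<Rightarrow> nat \<Rightarrow> real) \<Rightarrow> ennreal" where
  "op_norm E nE nF A = (SUP x\<in>{x\<in>E. nE x = 1}. ennreal (nF (mat_app A x)))"

definition op_norm_dec :: "(nat \<Rightarrow> real) set \<Rightarrow> ((nat \<Rightarrow> real) \<Rightarrow> real) \<Rightarrow>
    ((nat \<Rightarrow> real) \<Rightarrow> real) \<Rightarrow> (nat \<Rightarrow> nat \<Rightarrow> real) \<Rightarrow> ennreal" where
  "op_norm_dec E nE nF A =
     (SUP x\<in>{x\<in>E. nE x = 1 \<and> (\<forall>k. 0 \<le> x k) \<and> decseq x}. ennreal (nF (mat_app A x)))"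

section \<open>Row permutations\<close>

(* An n x \<infinity> matrix is represented by a doubly infinite one whose rows from n on vanish. *)
definition first_rows :: "nat \<Rightarrow> (nat \<Rightarrow> nat \<Rightarrow> real) \<Rightarrow> nat \<Rightarrow> nat \<Rightarrow> real" where
  "first_rows n A = (\<lambda>j k. if j < n then A j k else 0)"

definition row_perms :: "nat \<Rightarrow> (nat \<Rightarrow> nat \<Rightarrow> real) \<Rightarrow> (nat \<Rightarrow> nat \<Rightarrow> real) set" where
  "row_perms n D = {(\<lambda>j. D (p j)) | p. p permutes {..<n}}"

(* Here g and h are the upper indices gamma and lambda.  They refer to rows counted from 1,
   so the row B j is compared with them through its position Suc j. *)
definition row_perms_part ::
    "nat \<Rightarrow> (nat \<Rightarrow> nat \<Rightarrow> real) \<Rightarrow> nat \<Rightarrow> nat \<Rightarrow> (nat \<Rightarrow> nat \<Rightarrow> real) set" where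
  "row_perms_part n D g h =
     {B \<in> row_perms n D.
        (\<forall>j k. Suc j < n \<and> (Suc j \<le> g \<or> h \<le> Suc j) \<longrightarrow> B j k \<ge> B (Suc j) k) \<and>
        (\<forall>i<n. \<forall>j<n. \<forall>k. Suc i \<le> g \<and> g < Suc j \<and> Suc j < h \<longrightarrow> B i k \<ge> B j k) \<and>
        (\<forall>j<n. \<forall>i<n. \<forall>k. g < Suc j \<and> Suc j < h \<and> h \<le> Suc i \<longrightarrow> B j k \<ge> B i k) \<and>
        \<not> (\<exists>a<n. g < Suc a \<and> Suc a < h \<and>
             ((\<forall>j<n. \<forall>k. g < Suc j \<and> Suc j < h \<longrightarrow> B a k \<ge> B j k) \<or>
              (\<forall>j<n. \<forall>k. g < Suc j \<and> Suc j < h \<longrightarrow> B a k \<le> B j k)))}"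

end

(* For x >= 0 in E, arrange the first n entries of Ax decreasingly. Since x >= 0, a row that
   dominates (or is dominated by) all the others may be placed first (or last); repeating this
   puts the correspondingly permuted matrix B into one of the classes R^{gamma,lambda}.
   For the matrix C attached to B, Abel summation against the decreasing weights x* turns
   the inequalities between the partial sums of the column sums of B and C into
   sum_{j<l} (Bx)_j <= sum_{j<l} (C x')_j <= sum_{j<l} (A x')*_j, where x' = x*.
   As Bx is the rearrangement of P_n(Ax), property (PS) of F gives ||P_n(Ax)|| <= ||A x'||, and
   n tends to infinity. *)

theory Submission
  imports Defs
begin

section \<open>Decreasing rearrangements and property (PS)\<close>

lemma rearr_max:
  assumes "has_rearr x"
  shows "rearr x n \<in> min_vals x (Suc n)" and "s \<in> min_vals x (Suc n) \<Longrightarrow> s \<le> rearr x n"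
proof -
  obtain m where m: "m \<in> min_vals x (Suc n)" "\<forall>s\<in>min_vals x (Suc n). s \<le> m"
    using assms unfolding has_rearr_def by (metis le_add1 plus_1_eq_Suc)
  have "rearr x n = m"
    unfolding rearr_def by (rule Greatest_equality) (use m in auto)
  with m show "rearr x n \<in> min_vals x (Suc n)"
    and "s \<in> min_vals x (Suc n) \<Longrightarrow> s \<le> rearr x n" by auto
qed

text \<open>Lower bounds on \<open>rearr\<close> are obtained in this form, by exhibiting a set of
  indices instead of handling the minima in \<open>min_vals\<close>.\<close>

lemma le_rearr:
  assumes "has_rearr x" "finite N" "card N = Suc n" "\<And>k. k \<in> N \<Longrightarrow> c \<le> \<bar>x k\<bar>"
  shows "c \<le> rearr x n"
proof -
  have "N \<noteq> {}" using assms(3) by auto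
  then have "c \<le> Min ((\<lambda>k. \<bar>x k\<bar>) ` N)" using assms by auto
  also have "\<dots> \<le> rearr x n"
    using assms by (intro rearr_max(2)) (auto simp: min_vals_def)
  finally show ?thesis .
qed

lemma rearr_witness:
  assumes "has_rearr x"
  obtains N where "finite N" "card N = Suc n" "\<And>k. k \<in> N \<Longrightarrow> rearr x n \<le> \<bar>x k\<bar>"
proof -
  obtain N where N: "finite N" "card N = Suc n" "rearr x n = Min ((\<lambda>k. \<bar>x k\<bar>) ` N)"
    using rearr_max(1)[OF assms, of n] by (auto simp: min_vals_def)
  then have "rearr x n \<le> \<bar>x k\<bar>" if "k \<in> N" for k
    using that by auto
  with N that show ?thesis by blast
qed

lemma rearr_nonneg: "has_rearr x \<Longrightarrow> 0 \<le> rearr x n"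
  by (rule le_rearr[where N = "{..n}"]) auto

lemma decseq_rearr:
  assumes "has_rearr x" shows "decseq (rearr x)"
proof (rule decseq_SucI)
  fix n
  obtain N where N: "finite N" "card N = Suc (Suc n)" "\<And>k. k \<in> N \<Longrightarrow> rearr x (Suc n) \<le> \<bar>x k\<bar>"
    using rearr_witness[OF assms] by blast
  then obtain a where "a \<in> N" by fastforce
  with N show "rearr x (Suc n) \<le> rearr x n"
    by (intro le_rearr[OF assms, where N = "N - {a}"]) auto
qed

text \<open>Induction on the size of \<open>S\<close>, removing an index of least absolute value: by
  minimality, \<open>S\<close> itself witnesses that this value is at most the last term of the
  right-hand sum.\<close>

lemma sum_abs_le_sum_rearr:
  assumes "has_rearr x" "finite S"
  shows "(\<Sum>k\<in>S. \<bar>x k\<bar>) \<le> (\<Sum>i<card S. rearr x i)"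
  using assms(2)
proof (induction "card S" arbitrary: S)
  case (Suc m)
  note fin = Suc.prems and card = Suc.hyps(2)[symmetric]
  have ne: "S \<noteq> {}" using card by auto
  define a where "a = arg_min_on (\<lambda>k. \<bar>x k\<bar>) S"
  have a: "a \<in> S" "\<And>k. k \<in> S \<Longrightarrow> \<bar>x a\<bar> \<le> \<bar>x k\<bar>"
    using arg_min_if_finite(1)[OF fin ne] arg_min_least[OF fin ne] by (auto simp: a_def)
  have "\<bar>x a\<bar> \<le> rearr x m"
    by (rule le_rearr[OF assms(1) fin card a(2)])
  moreover have "card (S - {a}) = m" using card a(1) by simp
  then have "(\<Sum>k\<in>S - {a}. \<bar>x k\<bar>) \<le> (\<Sum>i<m. rearr x i)"
    using Suc.hyps(1)[of "S - {a}"] fin by simp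
  ultimately show ?case
    by (simp add: sum.remove[OF fin a(1)] card)
qed simp

text \<open>The first \<open>n + 1\<close> values of \<open>p\<close> attain the required maximum;
  every set of \<open>n + 1\<close> indices contains some \<open>p i\<close> with
  \<open>n \<le> i\<close>, so its minimum is no larger. This computes the rearrangement of a
  truncation once its entries are sorted.\<close>

lemma rearr_bij:
  assumes "bij p" "decseq (\<lambda>i. \<bar>x (p i)\<bar>)"
  shows "has_rearr x" and "rearr x = (\<lambda>i. \<bar>x (p i)\<bar>)"
proof -
  have dec: "\<bar>x (p j)\<bar> \<le> \<bar>x (p i)\<bar>" if "i \<le> j" for i j
    using decseqD[OF assms(2) that] .
  have mem: "\<bar>x (p n)\<bar> \<in> min_vals x (Suc n)" for n
  proof -
    have "Min ((\<lambda>k. \<bar>x k\<bar>) ` p ` {..n}) = \<bar>x (p n)\<bar>"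
      by (rule Min_eqI) (use dec in auto)
    moreover have "card (p ` {..n}) = Suc n"
      using inj_on_subset[OF bij_is_inj[OF assms(1)]] by (simp add: card_image)
    ultimately show ?thesis
      unfolding min_vals_def
      by (intro CollectI exI[of _ "p ` {..n}"]) simp
  qed
  have max: "s \<le> \<bar>x (p n)\<bar>" if s: "s \<in> min_vals x (Suc n)" for s n
  proof -
    obtain N where N: "finite N" "card N = Suc n" "s = Min ((\<lambda>k. \<bar>x k\<bar>) ` N)"
      using s by (auto simp: min_vals_def)
    have "card (p ` {..<n}) \<le> n" using card_image_le[of "{..<n}" p] by simp
    then have "\<not> N \<subseteq> p ` {..<n}"
      using N card_mono[of "p ` {..<n}" N] by auto
    then obtain k where "k \<in> N" "k \<notin> p ` {..<n}" by blast
    moreover obtain i where "k = p i" using bij_is_surj[OF assms(1)] by blast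
    ultimately have "p i \<in> N" "n \<le> i" by (auto simp: not_less)
    then have "s \<le> \<bar>x (p i)\<bar>" using N by auto
    also have "\<dots> \<le> \<bar>x (p n)\<bar>" using dec \<open>n \<le> i\<close> by blast
    finally show ?thesis .
  qed
  show "has_rearr x"
    unfolding has_rearr_def
  proof (intro allI impI)
    fix n :: nat assume "1 \<le> n"
    then obtain m where "n = Suc m" by (cases n) auto
    then show "\<exists>m\<in>min_vals x n. \<forall>s\<in>min_vals x n. s \<le> m" using mem max by blast
  qed
  show "rearr x = (\<lambda>i. \<bar>x (p i)\<bar>)"
    unfolding rearr_def by (intro ext Greatest_equality mem max)
qed

lemma rearr_decseq:
  assumes "decseq x" "\<And>k. 0 \<le> x k"
  shows "has_rearr x" and "rearr x = x"
  using rearr_bij[OF bij_id, of x] assms by simp_all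

text \<open>Since \<open>rearr x\<close> is its own rearrangement, the partial sums for
  \<open>x\<close> and \<open>rearr x\<close> coincide, and (PS) applies in both directions.\<close>

lemma property_PS_rearr:
  assumes "property_PS E nE" "x \<in> E"
  shows "has_rearr x" "rearr x \<in> E" "nE (rearr x) = nE x"
proof -
  show hx: "has_rearr x" using assms unfolding property_PS_def by blast
  note r = rearr_decseq[OF decseq_rearr[OF hx] rearr_nonneg[OF hx]]
  have PS: "v \<in> E \<and> nE v \<le> nE u" if "u \<in> E" "has_rearr v" "rearr v = rearr u" for u v
  proof -
    have "\<forall>n\<ge>1. (\<Sum>i<n. rearr v i) \<le> (\<Sum>i<n. rearr u i)" using that(3) by simp
    then show ?thesis using assms(1) that(1,2) unfolding property_PS_def by blast
  qed
  show mem: "rearr x \<in> E" using PS[OF assms(2) r] by blast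
  show "nE (rearr x) = nE x"
    using PS[OF assms(2) r] PS[OF mem hx] r(2) by (intro antisym) auto
qed

section \<open>Abel summation, sorting and a rearrangement inequality\<close>

lemma sum_mult_decseq_mono:
  fixes a b w :: "nat \<Rightarrow> real"
  assumes "\<And>m. (\<Sum>k<m. a k) \<le> (\<Sum>k<m. b k)" "decseq w" "\<And>k. 0 \<le> w k"
  shows "(\<Sum>k<n. a k * w k) \<le> (\<Sum>k<n. b k * w k)"
proof -
  define d where "d k = b k - a k" for k
  have d: "0 \<le> (\<Sum>k<m. d k)" for m
    using assms(1) by (simp add: d_def sum_subtractf)
  \<comment> \<open>Abel summation in inductive form: replacing \<open>w m\<close> by the smaller
    \<open>w (Suc m)\<close> can only lower the left side, because the partial sums of
    \<open>d\<close> are nonnegative.\<close>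
  have "(\<Sum>k<m. d k) * w m \<le> (\<Sum>k<m. d k * w k)" for m
  proof (induction m)
    case (Suc m)
    have "(\<Sum>k<Suc m. d k) * w (Suc m) \<le> (\<Sum>k<Suc m. d k) * w m"
      using assms(2) by (intro mult_left_mono d) (auto simp: decseq_Suc_iff)
    with Suc show ?case by (simp add: algebra_simps)
  qed simp
  then have "0 \<le> (\<Sum>k<n. d k * w k)"
    by (rule order_trans[rotated]) (intro mult_nonneg_nonneg d assms)
  then show ?thesis
    by (simp add: d_def sum_subtractf left_diff_distrib)
qed

lemma permutation_of_list:
  assumes "distinct L" "set L = {..<n}"
  shows "(\<lambda>i. if i < n then L ! i else i) permutes {..<n}"
proof (rule bij_imp_permutes)
  have len: "length L = n" using assms distinct_card by fastforce
  then have "bij_betw (\<lambda>i. L ! i) {..<n} {..<n}"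
    using bij_betw_nth[OF assms(1)] assms(2) by blast
  then show "bij_betw (\<lambda>i. if i < n then L ! i else i) {..<n} {..<n}"
    by (rule bij_betw_cong[THEN iffD1, rotated]) auto
qed auto

text \<open>Nonnegativity keeps the sequence decreasing at index \<open>n\<close>, where the sorted
  entries give way to the zeros of the truncation.\<close>

lemma decseq_trunc_list:
  fixes y :: "nat \<Rightarrow> real"
  assumes "distinct L" "set L = {..<n}" "sorted_wrt (\<lambda>a b. y b \<le> y a) L" "\<And>k. 0 \<le> y k"
  shows "decseq (\<lambda>i. trunc_seq n y (if i < n then L ! i else i))"
proof (rule decseq_SucI)
  fix i
  have len: "length L = n" using assms distinct_card by fastforce
  then have "L ! i < n" if "i < n" for i using that assms(2) nth_mem by blast
  then show "trunc_seq n y (if Suc i < n then L ! Suc i else Suc i)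
      \<le> trunc_seq n y (if i < n then L ! i else i)"
    using assms(3,4) len by (auto simp: trunc_seq_def sorted_wrt_iff_nth_less)
qed

lemma sorting_list:
  fixes f :: "nat \<Rightarrow> real"
  assumes "finite S"
  obtains L where "distinct L" "set L = S" "sorted_wrt (\<lambda>a b. f b \<le> f a) L"
proof -
  let ?L = "sort_key (\<lambda>i. - f i) (sorted_list_of_set S)"
  have "sorted (map (\<lambda>i. - f i) ?L)" by simp
  then have "sorted_wrt (\<lambda>a b. f b \<le> f a) ?L" by (simp add: sorted_wrt_map)
  with that[of ?L] assms show ?thesis by simp
qed

lemma sorting_permutation:
  fixes y :: "nat \<Rightarrow> real"
  assumes "\<And>k. 0 \<le> y k"
  obtains p where "p permutes {..<n}" "decseq (\<lambda>i. trunc_seq n y (p i))"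
proof -
  obtain L where L: "distinct L" "set L = {..<n}" "sorted_wrt (\<lambda>a b. y b \<le> y a) L"
    using sorting_list[of "{..<n}" y] by blast
  show thesis
    by (rule that[OF permutation_of_list[OF L(1,2)] decseq_trunc_list[OF L assms]])
qed

text \<open>A Hardy-Littlewood type inequality: sort the first \<open>n\<close> entries of
  \<open>x\<close>, compare \<open>u\<close> with \<open>v\<close> by Abel summation, then pass from
  the sorted entries to \<open>rearr x\<close>. In the application \<open>u\<close> and
  \<open>v\<close> are column sums over the first rows of two row-permuted matrices.\<close>

lemma sum_mult_le_suminf_rearr:
  fixes u v x :: "nat \<Rightarrow> real"
  assumes le: "\<And>N. finite N \<Longrightarrow> (\<Sum>k\<in>N. u k) \<le> (\<Sum>k<card N. v k)"
    and v: "\<And>k. 0 \<le> v k" and x: "\<And>k. 0 \<le> x k" "has_rearr x"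
    and summ: "summable (\<lambda>k. v k * rearr x k)"
  shows "(\<Sum>k<n. u k * x k) \<le> (\<Sum>k. v k * rearr x k)"
proof -
  obtain p where p: "p permutes {..<n}" "decseq (\<lambda>i. trunc_seq n x (p i))"
    using sorting_permutation[of x n] x by blast
  have inj: "inj_on p X" for X using permutes_inj_on[OF p(1)] .
  have lt: "p i < n \<longleftrightarrow> i < n" for i using permutes_in_image[OF p(1), of i] by simp
  have "(\<Sum>k<n. u k * x k) = (\<Sum>k<n. u (p k) * x (p k))"
    using sum.permute[OF p(1)] by (simp add: o_def)
  also have "\<dots> = (\<Sum>k<n. u (p k) * trunc_seq n x (p k))"
    by (simp add: trunc_seq_def lt)
  \<comment> \<open>Partial sums of \<open>u\<close> along \<open>p\<close> run over sets of columns
    that depend on \<open>x\<close>, which is why \<open>le\<close> speaks of arbitrary finite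
    sets.\<close>
  also have "\<dots> \<le> (\<Sum>k<n. v k * trunc_seq n x (p k))"
  proof (rule sum_mult_decseq_mono[OF _ p(2)])
    fix m
    have "(\<Sum>k<m. u (p k)) = (\<Sum>k\<in>p ` {..<m}. u k)"
      using inj by (simp add: sum.reindex)
    also have "\<dots> \<le> (\<Sum>k<m. v k)"
      using le[of "p ` {..<m}"] inj by (simp add: card_image)
    finally show "(\<Sum>k<m. u (p k)) \<le> (\<Sum>k<m. v k)" .
  qed (auto simp: trunc_seq_def x)
  \<comment> \<open>Each sorted entry is at most the corresponding term of \<open>rearr x\<close>:
    the image of \<open>{..k}\<close> under \<open>p\<close> supplies \<open>k + 1\<close> indices
    with values at least as large.\<close>
  also have "\<dots> \<le> (\<Sum>k<n. v k * rearr x k)"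
  proof (intro sum_mono mult_left_mono v le_rearr[OF x(2)])
    fix k show "finite (p ` {..k})" by simp
    show "card (p ` {..k}) = Suc k" using inj by (simp add: card_image)
    fix j assume "j \<in> p ` {..k}"
    then have "trunc_seq n x (p k) \<le> trunc_seq n x j" using p(2) by (auto simp: decseq_def)
    also have "\<dots> \<le> \<bar>x j\<bar>" by (simp add: trunc_seq_def abs_ge_self)
    finally show "trunc_seq n x (p k) \<le> \<bar>x j\<bar>" .
  qed
  also have "\<dots> \<le> (\<Sum>k. v k * rearr x k)"
    using summ v x by (intro sum_le_suminf) (auto simp: rearr_nonneg)
  finally show ?thesis .
qed

section \<open>Arranging rows into the classes \<open>row_perms_part\<close>\<close>

text \<open>Greatest elements for \<open>R\<close> are moved repeatedly to the front and least ones to the back;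
  what remains has neither, and is sorted by \<open>f\<close>.\<close>
lemma peeling_list:
  fixes f :: "nat \<Rightarrow> real" and R :: "nat \<Rightarrow> nat \<Rightarrow> bool"
  assumes "finite S" "\<forall>a\<in>S. \<forall>b\<in>S. R a b \<longrightarrow> f b \<le> f a"
  shows "\<exists>xs ms ys. distinct (xs @ ms @ ys) \<and> set (xs @ ms @ ys) = S \<and>
    sorted_wrt (\<lambda>a b. f b \<le> f a) (xs @ ms @ ys) \<and>
    sorted_wrt R xs \<and> sorted_wrt R ys \<and>
    (\<forall>a\<in>set xs. \<forall>b\<in>set ms \<union> set ys. R a b) \<and> (\<forall>a\<in>set ms. \<forall>b\<in>set ys. R a b) \<and>
    \<not> (\<exists>a\<in>set ms. (\<forall>b\<in>set ms. R a b) \<or> (\<forall>b\<in>set ms. R b a))"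
proof -
  define P where "P S xs ms ys \<longleftrightarrow> distinct (xs @ ms @ ys) \<and> set (xs @ ms @ ys) = S \<and>
    sorted_wrt (\<lambda>a b. f b \<le> f a) (xs @ ms @ ys) \<and>
    sorted_wrt R xs \<and> sorted_wrt R ys \<and>
    (\<forall>a\<in>set xs. \<forall>b\<in>set ms \<union> set ys. R a b) \<and> (\<forall>a\<in>set ms. \<forall>b\<in>set ys. R a b) \<and>
    \<not> (\<exists>a\<in>set ms. (\<forall>b\<in>set ms. R a b) \<or> (\<forall>b\<in>set ms. R b a))" for S xs ms ys
  have "\<exists>xs ms ys. P S xs ms ys"
    using assms(1,2)
  proof (induction "card S" arbitrary: S)
    case 0
    then show ?case by (intro exI[of _ "[]"]) (simp add: P_def)
  next
    case (Suc m)
    have IH: "\<exists>xs ms ys. P (S - {a}) xs ms ys" if "a \<in> S" for a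
      by (rule Suc.hyps(1)) (use Suc.hyps(2) Suc.prems that in auto)
    consider (top) a where "a \<in> S" "\<forall>b\<in>S. R a b" | (bot) a where "a \<in> S" "\<forall>b\<in>S. R b a"
      | (none) "\<not> (\<exists>a\<in>S. (\<forall>b\<in>S. R a b) \<or> (\<forall>b\<in>S. R b a))" by blast
    then show ?case
    proof cases
      case top
      obtain xs ms ys where *: "P (S - {a}) xs ms ys" using IH[OF top(1)] by blast
      have S: "set xs \<union> set ms \<union> set ys = S - {a}" using * by (auto simp: P_def)
      \<comment> \<open>As \<open>f\<close> respects \<open>R\<close>, an element dominating all of
        \<open>S\<close> can go in front without disturbing the order by \<open>f\<close>.\<close>
      have "\<forall>b\<in>set xs \<union> set ms \<union> set ys. R a b \<and> f b \<le> f a"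
        unfolding S using top Suc.prems(2) by blast
      moreover have "S = insert a (set xs \<union> set ms \<union> set ys)"
        "a \<notin> set xs \<union> set ms \<union> set ys" using S top by auto
      ultimately have "P S (a # xs) ms ys"
        using * unfolding P_def by (simp add: ball_Un Un_assoc)
      then show ?thesis by blast
    next
      case bot
      obtain xs ms ys where *: "P (S - {a}) xs ms ys" using IH[OF bot(1)] by blast
      have S: "set xs \<union> set ms \<union> set ys = S - {a}" using * by (auto simp: P_def)
      have "\<forall>b\<in>set xs \<union> set ms \<union> set ys. R b a \<and> f a \<le> f b"
        unfolding S using bot Suc.prems(2) by blast
      moreover have "S = insert a (set xs \<union> set ms \<union> set ys)"
        "a \<notin> set xs \<union> set ms \<union> set ys" using S bot by auto
      ultimately have "P S xs ms (ys @ [a])"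
        using * unfolding P_def by (simp add: sorted_wrt_append ball_Un Un_assoc)
      then show ?thesis by blast
    next
      case none
      obtain L where "distinct L" "set L = S" "sorted_wrt (\<lambda>a b. f b \<le> f a) L"
        using sorting_list[OF Suc.prems(1)] .
      with none have "P S [] L []" by (simp add: P_def)
      then show ?thesis by blast
    qed
  qed
  then show ?thesis unfolding P_def .
qed

text \<open>A single permutation must both sort \<open>y\<close> and bring the rows into some class.
  Peeling with row domination as \<open>R\<close> achieves both, because \<open>y\<close> respects
  domination.\<close>

lemma sorted_row_permutation:
  fixes D :: "nat \<Rightarrow> nat \<Rightarrow> real" and y :: "nat \<Rightarrow> real"
  assumes mono: "\<And>a b. a < n \<Longrightarrow> b < n \<Longrightarrow> (\<And>k. D b k \<le> D a k) \<Longrightarrow> y b \<le> y a"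
    and y: "\<And>k. 0 \<le> y k"
  obtains p g h where "p permutes {..<n}" "decseq (\<lambda>i. trunc_seq n y (p i))"
    "(\<lambda>j. D (p j)) \<in> row_perms_part n D g h" "g \<le> h" "h \<le> n + 1"
proof -
  define R where "R a b \<longleftrightarrow> (\<forall>k. D b k \<le> D a k)" for a b
  have R_mono: "\<forall>a\<in>{..<n}. \<forall>b\<in>{..<n}. R a b \<longrightarrow> y b \<le> y a"
    using mono by (simp add: R_def)
  obtain xs ms ys where
    L: "distinct (xs @ ms @ ys)" "set (xs @ ms @ ys) = {..<n}"
      "sorted_wrt (\<lambda>a b. y b \<le> y a) (xs @ ms @ ys)" and
    R: "sorted_wrt R xs" "sorted_wrt R ys"
      "\<forall>a\<in>set xs. \<forall>b\<in>set ms \<union> set ys. R a b" "\<forall>a\<in>set ms. \<forall>b\<in>set ys. R a b"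
      "\<not> (\<exists>a\<in>set ms. (\<forall>b\<in>set ms. R a b) \<or> (\<forall>b\<in>set ms. R b a))"
    using peeling_list[of "{..<n}" R y, OF finite_lessThan R_mono]
    by (elim exE conjE) (rule that)
  define L where "L = xs @ ms @ ys"
  define p where "p i = (if i < n then L ! i else i)" for i
  \<comment> \<open>Rows are counted from 1 here: the first block ends at row \<open>g\<close> and
    the last one begins at row \<open>h\<close>, with \<open>h = n + 1\<close> if it is empty. The
    middle block is \<open>g < Suc i < h\<close>.\<close>
  define g where "g = length xs"
  define h where "h = length xs + length ms + 1"
  have len: "length L = n" using distinct_card[OF L(1)] unfolding L(2) L_def by simp
  \<comment> \<open>Covers condition (i) up to \<open>g\<close> and the first half of (ii);
    \<open>bottom\<close> does the same for the last block.\<close>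
  have top: "R (p i) (p j)" if "i < j" "j < n" "i < g" for i j
  proof (cases "j < g")
    case True
    with that R(1) show ?thesis
      by (simp add: p_def L_def g_def nth_append sorted_wrt_iff_nth_less)
  next
    case False
    then have "L ! j \<in> set (ms @ ys)"
      using that len by (auto simp: L_def g_def nth_append)
    with that R(3) show ?thesis
      by (simp add: p_def L_def g_def nth_append)
  qed
  have bottom: "R (p i) (p j)" if "i < j" "j < n" "h \<le> Suc j" for i j
  proof -
    have eq: "L ! j = ys ! (j - length xs - length ms)" "j - length xs - length ms < length ys"
      using that len by (auto simp: L_def h_def nth_append)
    then have mem: "L ! j \<in> set ys" by simp
    consider "i < g" | "g \<le> i" "Suc i < h" | "h \<le> Suc i" by linarith
    then show ?thesis
    proof cases
      case 1 then show ?thesis using top that by blast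
    next
      case 2
      then have "L ! i \<in> set ms" using that len by (auto simp: L_def g_def h_def nth_append)
      with mem R(4) that show ?thesis by (simp add: p_def)
    next
      case 3
      then have "L ! i = ys ! (i - length xs - length ms)"
        using that len by (auto simp: L_def h_def nth_append)
      moreover have "i - length xs - length ms < j - length xs - length ms"
        using 3 that by (auto simp: h_def)
      ultimately show ?thesis
        using R(2) eq that by (simp add: p_def sorted_wrt_iff_nth_less)
    qed
  qed
  \<comment> \<open>Identifies the positions strictly between \<open>g\<close> and \<open>h\<close>
    with \<open>ms\<close>, so that the absence of extreme elements in \<open>ms\<close> becomes
    condition (iii).\<close>
  have middle: "p ` {i. i < n \<and> g < Suc i \<and> Suc i < h} = set ms"
  proof -
    have "p i \<in> set ms" if "i < n" "g < Suc i" "Suc i < h" for i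
      using that by (auto simp: p_def L_def g_def h_def nth_append)
    moreover have "p (g + i) = ms ! i" "g + i < n" if "i < length ms" for i
      using that len by (auto simp: p_def L_def g_def nth_append)
    then have "ms ! i \<in> p ` {i. i < n \<and> g < Suc i \<and> Suc i < h}" if "i < length ms" for i
      using that by (intro image_eqI[of _ _ "g + i"]) (auto simp: g_def h_def)
    ultimately show ?thesis
      by (intro equalityI subsetI) (auto simp: in_set_conv_nth)
  qed
  have perm: "p permutes {..<n}"
    using permutation_of_list[OF L(1,2)] unfolding p_def L_def .
  moreover have "decseq (\<lambda>i. trunc_seq n y (p i))"
    using decseq_trunc_list[OF L y] unfolding p_def L_def .
  moreover have "(\<lambda>j. D (p j)) \<in> row_perms_part n D g h"
  proof -
    have "(\<lambda>j. D (p j)) \<in> row_perms n D" unfolding row_perms_def using perm by blast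
    moreover have "D (p (Suc j)) k \<le> D (p j) k" if "Suc j < n" "Suc j \<le> g \<or> h \<le> Suc j" for j k
      using top[of j "Suc j"] bottom[of j "Suc j"] that by (auto simp: R_def)
    moreover have "D (p j) k \<le> D (p i) k" if "j < n" "Suc i \<le> g" "g < Suc j" for i j k
      using top[of i j] that by (auto simp: R_def)
    moreover have "D (p i) k \<le> D (p j) k" if "i < n" "Suc j < h" "h \<le> Suc i" for i j k
      using bottom[of j i] that by (auto simp: R_def)
    moreover have False if a: "a < n" "g < Suc a" "Suc a < h" and
      ext: "(\<forall>j<n. \<forall>k. g < Suc j \<and> Suc j < h \<longrightarrow> D (p j) k \<le> D (p a) k) \<or>
         (\<forall>j<n. \<forall>k. g < Suc j \<and> Suc j < h \<longrightarrow> D (p a) k \<le> D (p j) k)" for a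
    proof -
      have "p a \<in> set ms" unfolding middle[symmetric] using a by blast
      moreover have "(\<forall>b\<in>set ms. R (p a) b) \<or> (\<forall>b\<in>set ms. R b (p a))"
        using ext unfolding middle[symmetric] R_def by auto
      ultimately show False using R(5) by blast
    qed
    ultimately show ?thesis
      unfolding row_perms_part_def by (intro CollectI conjI allI impI notI) (auto, blast+)
  qed
  moreover have "g \<le> h" "h \<le> n + 1" using len by (auto simp: g_def h_def L_def)
  ultimately show thesis using that by blast
qed


section \<open>Comparison of \<open>A x\<close> with \<open>A (rearr x)\<close> and equality of the
  two operator norms\<close>

theorem theorem3p2:
  fixes E F :: "(nat \<Rightarrow> real) set"
    and nE nF :: "(nat \<Rightarrow> real) \<Rightarrow> real"
    and A :: "nat \<Rightarrow> nat \<Rightarrow> real"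
    and n0 :: nat
  assumes "normed_riesz_seq_space E nE" and "property_PS E nE"
    and "normed_riesz_seq_space F nF" and "property_PS F nF"
    and "\<And>x. x \<in> F \<Longrightarrow> (\<lambda>n. nF (trunc_seq n x)) \<longlonglongrightarrow> nF x"
    and "\<And>j k. A j k \<ge> 0"
    and "defines_operator A E F"
    and "n0 > 0"
    and "\<And>n B. \<lbrakk>n \<ge> n0;
             B \<in> \<Union> {row_perms_part n (first_rows n A) g h | g h. g \<le> h \<and> h \<le> n + 1}\<rbrakk> \<Longrightarrow>
           \<exists>C \<in> row_perms n (first_rows n A).
             \<forall>l r N. 1 \<le> l \<and> l \<le> n \<and> 1 \<le> r \<and> finite N \<and> card N = r \<longrightarrow>
               (\<Sum>j<l. \<Sum>k<r. C j k) \<ge> (\<Sum>j<l. \<Sum>k\<in>N. B j k)"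
  shows "(\<forall>x\<in>E. (\<forall>k. 0 \<le> x k) \<longrightarrow> nF (mat_app A (rearr x)) \<ge> nF (mat_app A x)) \<and>
         op_norm E nE nF A = op_norm_dec E nE nF A"
proof -
  interpret E: normed_riesz_seq_space E nE by fact
  interpret F: normed_riesz_seq_space F nF by fact
  note PSE = assms(2) and PSF = assms(4) and A = assms(6)
  have summ: "summable (\<lambda>k. A j k * x k)" and app: "mat_app A x \<in> F" if "x \<in> E" for x j
    using assms(7) that by (auto simp: defines_operator_def)
  have main: "nF (mat_app A x) \<le> nF (mat_app A (rearr x))" if x: "x \<in> E" "\<And>k. 0 \<le> x k" for x
  proof -
    note rx = property_PS_rearr[OF PSE x(1)]
    define y where "y = mat_app A x"
    define z where "z = mat_app A (rearr x)"
    have yF: "y \<in> F" and zF: "z \<in> F" unfolding y_def z_def using app x rx by auto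
    have hz: "has_rearr z" using property_PS_rearr[OF PSF zF] by blast
    have y0: "0 \<le> y j" and z0: "0 \<le> z j" for j
      using A x rx summ rearr_nonneg by (auto simp: y_def z_def mat_app_def intro!: suminf_nonneg)
    have "nF (trunc_seq n y) \<le> nF z" if n: "n \<ge> n0" for n
    proof -
      \<comment> \<open>Since \<open>x\<close> is nonnegative, domination between rows passes to the
        entries of \<open>A x\<close>.\<close>
      have mono: "y b \<le> y a" if "a < n" "b < n" "\<And>k. first_rows n A b k \<le> first_rows n A a k" for a b
        unfolding y_def mat_app_def using that x
        by (intro suminf_le summ mult_right_mono) (auto simp: first_rows_def)
      obtain p g h where p: "p permutes {..<n}" "decseq (\<lambda>i. trunc_seq n y (p i))"
        and part: "(\<lambda>j. first_rows n A (p j)) \<in> row_perms_part n (first_rows n A) g h"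
        and gh: "g \<le> h" "h \<le> n + 1"
        using sorted_row_permutation[of n "first_rows n A" y] mono y0 by blast
      \<comment> \<open>\<open>q\<close> is the row permutation behind the matrix C that the
        hypothesis attaches to the rows permuted by \<open>p\<close>.\<close>
      obtain q where q: "q permutes {..<n}" and
        C: "\<And>l N. 1 \<le> l \<Longrightarrow> l \<le> n \<Longrightarrow> 1 \<le> card N \<Longrightarrow> finite N \<Longrightarrow>
          (\<Sum>j<l. \<Sum>k\<in>N. first_rows n A (p j) k) \<le> (\<Sum>j<l. \<Sum>k<card N. first_rows n A (q j) k)"
        using assms(9)[OF n, of "\<lambda>j. first_rows n A (p j)"] part gh
        unfolding row_perms_def by blast
      have pn: "p j < n \<longleftrightarrow> j < n" and qn: "q j < n \<longleftrightarrow> j < n" for j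
        using permutes_in_image[OF p(1), of j] permutes_in_image[OF q, of j] by auto
      have le: "(\<Sum>j<l. y (p j)) \<le> (\<Sum>j<l. rearr z j)" if l: "l \<le> n" for l
      proof (cases "l = 0")
        case False
        \<comment> \<open>Column sums over the first \<open>l\<close> rows turn the hypothesis on B
          and C into the hypothesis \<open>le\<close> of
          \<open>sum_mult_le_suminf_rearr\<close>.\<close>
        define u where "u k = (\<Sum>j<l. A (p j) k)" for k
        define v where "v k = (\<Sum>j<l. A (q j) k)" for k
        have uv: "(\<Sum>k\<in>N. u k) \<le> (\<Sum>k<card N. v k)" if "finite N" for N
        proof (cases "N = {}")
          case False
          then have "1 \<le> card N" using that by (simp add: Suc_le_eq card_gt_0_iff)
          with C[of l N] \<open>l \<noteq> 0\<close> l that show ?thesis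
            unfolding u_def v_def by (subst (1 2) sum.swap) (simp add: first_rows_def pn qn)
        qed simp
        have sums_u: "(\<lambda>k. u k * x k) sums (\<Sum>j<l. y (p j))"
          unfolding u_def y_def mat_app_def sum_distrib_right
          by (intro sums_sum summable_sums summ x)
        have sums_v: "(\<lambda>k. v k * rearr x k) sums (\<Sum>j<l. z (q j))"
          unfolding v_def z_def mat_app_def sum_distrib_right
          by (intro sums_sum summable_sums summ rx)
        have "(\<Sum>k<m. u k * x k) \<le> (\<Sum>j<l. z (q j))" for m
          using sum_mult_le_suminf_rearr[OF uv _ x(2) rx(1) sums_summable[OF sums_v]]
          by (simp add: sums_unique[OF sums_v] v_def A sum_nonneg)
        then have "(\<Sum>j<l. y (p j)) \<le> (\<Sum>j<l. z (q j))"
          using sums_u unfolding sums_def by (intro LIMSEQ_le_const2) auto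
        \<comment> \<open>These are \<open>l\<close> distinct entries of \<open>z\<close>, so the
          first \<open>l\<close> terms of \<open>rearr z\<close> bound their sum.\<close>
        also have "\<dots> = (\<Sum>k\<in>q ` {..<l}. \<bar>z k\<bar>)"
          using permutes_inj_on[OF q] z0 by (simp add: sum.reindex)
        also have "\<dots> \<le> (\<Sum>j<l. rearr z j)"
          using sum_abs_le_sum_rearr[OF hz, of "q ` {..<l}"] permutes_inj_on[OF q]
          by (simp add: card_image)
        finally show ?thesis .
      qed simp
      have "\<bar>trunc_seq n y k\<bar> = trunc_seq n y k" for k by (simp add: trunc_seq_def y0)
      then have r: "has_rearr (trunc_seq n y)" "rearr (trunc_seq n y) = (\<lambda>i. trunc_seq n y (p i))"
        using rearr_bij[OF permutes_bij[OF p(1)], of "trunc_seq n y"] p(2) by simp_all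
      have "(\<Sum>i<m. rearr (trunc_seq n y) i) \<le> (\<Sum>i<m. rearr z i)" for m
      proof -
        \<comment> \<open>From index \<open>n\<close> on the left terms vanish, while those of
          \<open>rearr z\<close> stay nonnegative; hence \<open>le\<close> up to \<open>n\<close>
          suffices.\<close>
        have "(\<Sum>i<m. rearr (trunc_seq n y) i) = (\<Sum>i<min m n. y (p i))"
          unfolding r by (rule sum.mono_neutral_cong_right) (auto simp: trunc_seq_def pn)
        also have "\<dots> \<le> (\<Sum>i<min m n. rearr z i)" by (rule le) simp
        also have "\<dots> \<le> (\<Sum>i<m. rearr z i)"
          using hz by (intro sum_mono2) (auto simp: rearr_nonneg)
        finally show ?thesis .
      qed
      then show ?thesis using PSF zF r(1) unfolding property_PS_def by blast
    qed
    then show ?thesis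
      using assms(5)[OF yF] unfolding y_def z_def by (intro LIMSEQ_le_const2) auto
  qed
  have "op_norm E nE nF A \<le> op_norm_dec E nE nF A"
    unfolding op_norm_def
  proof (rule SUP_least)
    fix x assume "x \<in> {x \<in> E. nE x = 1}"
    then have x: "x \<in> E" "nE x = 1" by auto
    define a where "a k = \<bar>x k\<bar>" for k
    \<comment> \<open>The lattice operations give membership of the absolute value of
      \<open>x\<close>, which reduces the norm bound to nonnegative sequences because
      \<open>A\<close> is nonnegative.\<close>
    have "(\<lambda>k. max (x k) ((-1) * x k)) \<in> E" by (intro E.max_mem E.scale_mem x)
    also have "(\<lambda>k. max (x k) ((-1) * x k)) = a" by (auto simp: a_def)
    finally have aE: "a \<in> E" .
    have "nE a = nE x" by (intro antisym E.nrm_mono x aE) (auto simp: a_def)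
    note ra = property_PS_rearr[OF PSE aE]
    have "nF (mat_app A x) \<le> nF (mat_app A a)"
    proof (intro F.nrm_mono app x aE)
      fix j
      have abs: "\<bar>A j k * x k\<bar> = A j k * a k" for k using A by (simp add: abs_mult a_def)
      show "\<bar>mat_app A x j\<bar> \<le> \<bar>mat_app A a j\<bar>"
        using summable_rabs[of "\<lambda>k. A j k * x k"] summ[OF aE, of j]
        unfolding mat_app_def abs by simp
    qed
    also have "\<dots> \<le> nF (mat_app A (rearr a))" by (intro main aE) (simp add: a_def)
    finally have "ennreal (nF (mat_app A x)) \<le> ennreal (nF (mat_app A (rearr a)))"
      by (rule ennreal_leI)
    \<comment> \<open>\<open>rearr a\<close> competes in the restricted supremum: by (PS) its norm
      is that of \<open>a\<close>, hence 1.\<close>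
    also have "\<dots> \<le> op_norm_dec E nE nF A"
      unfolding op_norm_dec_def using ra \<open>nE a = nE x\<close> x(2)
      by (intro SUP_upper) (auto simp: rearr_nonneg decseq_rearr)
    finally show "ennreal (nF (mat_app A x)) \<le> op_norm_dec E nE nF A" .
  qed
  moreover have "op_norm_dec E nE nF A \<le> op_norm E nE nF A"
    unfolding op_norm_def op_norm_dec_def by (rule SUP_subset_mono) auto
  ultimately show ?thesis using main by (auto intro: antisym)
qed

end
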